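(* Let $R$ be a commutative ring with unity and let $\Gamma$ be a commutative cancellative monoid of finite type with Grothendieck group $G(\Gamma)$. Let $$\mathcal F^f(G(\Gamma),R):=\{\alpha:G(\Gamma)\to R\;:\;\exists d\in\Gamma \text{ such that } \forall q\in G(\Gamma),\ \alpha(q)\neq0\Rightarrow dq\in\Gamma\},$$ with the operations $(\alpha+\beta)(q):=\alpha(q)+\beta(q)$ and $(\alpha\cdot\beta)(q):=\sum_{q'q''=q}\alpha(q')\beta(q'')$ for $q\in G(\Gamma)$. Then $(\mathcal F^f(G(\Gamma),R),+,\cdot)$ is an $R$-algebra. Moreover, the map $$i_*:\mathcal F(\Gamma,R)\to\mathcal F^f(G(\Gamma),R),\quad i_*(\alpha)(q):=\begin{cases}\alpha(q), & q\in\Gamma\\ 0, & q\notin\Gamma\end{cases}$$ is an injective morphism of $R$-algebras, hence $\mathcal F^f(G(\Gamma),R)$ is an extension of the ring $\mathcal F(\Gamma,R)$.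
   Context: A monoid $(\Gamma,\cdot,1)$ is of finite type if for each $n\in\Gamma$ the set $\{(a,b)\in\Gamma\times\Gamma : n=ab\}$ is finite, and cancellative if $xy=xz$ implies $y=z$. The Grothendieck group $G(\Gamma)$ is the abelian group of fractions $\frac mn$ ($m,n\in\Gamma$), i.e. $\Gamma\times\Gamma$ modulo $(m,n)\sim(p,q)\Leftrightarrow mq=np$, with $\frac mn\cdot\frac{m'}{n'}=\frac{mm'}{nn'}$; $\Gamma$ is viewed as a subset of $G(\Gamma)$ via the injection $n\mapsto\frac n1$. $\mathcal F(\Gamma,R)$ is the $R$-algebra of all functions $\alpha:\Gamma\to R$ under pointwise addition, pointwise scalar multiplication, and $(\alpha\cdot\beta)(n)=\sum_{ab=n}\alpha(a)\beta(b)$. The $R$-module structure on $\mathcal F^f(G(\Gamma),R)$ is pointwise. The sum defining $(\alpha\cdot\beta)(q)$ is over all pairs $(q',q'')\in G(\Gamma)^2$ with $q'q''=q$, and is understood as the sum of its nonzero terms; that these are finite in number (so that the product is well defined) and that the operations stay in $\mathcal F^f(G(\Gamma),R)$ is part of the assertion. *)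

theory Defs
  imports "HOL-Algebra.Algebra"
begin

definition finite_type :: "('g, 'm) monoid_scheme \<Rightarrow> bool" where
  "finite_type \<Gamma> \<longleftrightarrow>
     (\<forall>n \<in> carrier \<Gamma>. finite {(a, b). a \<in> carrier \<Gamma> \<and> b \<in> carrier \<Gamma> \<and> n = a \<otimes>\<^bsub>\<Gamma>\<^esub> b})"


section \<open>The Grothendieck group\<close>

definition frac_rel :: "('g, 'm) monoid_scheme \<Rightarrow> (('g \<times> 'g) \<times> ('g \<times> 'g)) set" where
  "frac_rel \<Gamma> = {((m, n), (p, q)).
     m \<in> carrier \<Gamma> \<and> n \<in> carrier \<Gamma> \<and> p \<in> carrier \<Gamma> \<and> q \<in> carrier \<Gamma> \<and>
     m \<otimes>\<^bsub>\<Gamma>\<^esub> q = n \<otimes>\<^bsub>\<Gamma>\<^esub> p}"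

definition frac :: "('g, 'm) monoid_scheme \<Rightarrow> 'g \<Rightarrow> 'g \<Rightarrow> ('g \<times> 'g) set" where
  "frac \<Gamma> m n = frac_rel \<Gamma> `` {(m, n)}"

text \<open>The product is the union of the classes of all products of representatives; these
  classes coincide, see \<open>Groth_mult_frac\<close> below.\<close>

definition Groth :: "('g, 'm) monoid_scheme \<Rightarrow> ('g \<times> 'g) set monoid" where
  "Groth \<Gamma> =
     \<lparr> carrier = (carrier \<Gamma> \<times> carrier \<Gamma>) // frac_rel \<Gamma>,
       monoid.mult = (\<lambda>x y. \<Union>(m, n) \<in> x. \<Union>(m', n') \<in> y. frac \<Gamma> (m \<otimes>\<^bsub>\<Gamma>\<^esub> m') (n \<otimes>\<^bsub>\<Gamma>\<^esub> n')),
       one = frac \<Gamma> \<one>\<^bsub>\<Gamma>\<^esub> \<one>\<^bsub>\<Gamma>\<^esub> \<rparr>"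

definition Groth_incl :: "('g, 'm) monoid_scheme \<Rightarrow> 'g \<Rightarrow> ('g \<times> 'g) set" where
  "Groth_incl \<Gamma> n = frac \<Gamma> n \<one>\<^bsub>\<Gamma>\<^esub>"

abbreviation Groth_image :: "('g, 'm) monoid_scheme \<Rightarrow> ('g \<times> 'g) set set" where
  "Groth_image \<Gamma> \<equiv> Groth_incl \<Gamma> ` carrier \<Gamma>"

context comm_monoid_cancel
begin

lemma equiv_frac_rel: "equiv (carrier G \<times> carrier G) (frac_rel G)"
proof (rule equivI)
  show "frac_rel G \<subseteq> (carrier G \<times> carrier G) \<times> (carrier G \<times> carrier G)"
    by (auto simp: frac_rel_def)
  show "refl_on (carrier G \<times> carrier G) (frac_rel G)"
    by (auto simp: refl_on_def frac_rel_def m_comm)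
  show "sym (frac_rel G)"
    by (auto simp: sym_def frac_rel_def m_comm)
  show "trans (frac_rel G)"
  proof (rule transI, clarify)
    fix m n p q r s
    assume 1: "((m, n), (p, q)) \<in> frac_rel G" and 2: "((p, q), (r, s)) \<in> frac_rel G"
    then have c: "m \<in> carrier G" "n \<in> carrier G" "p \<in> carrier G" "q \<in> carrier G"
        "r \<in> carrier G" "s \<in> carrier G"
      and e: "m \<otimes> q = n \<otimes> p" "p \<otimes> s = q \<otimes> r"
      by (auto simp: frac_rel_def)
    have "q \<otimes> (m \<otimes> s) = (m \<otimes> q) \<otimes> s" using c by (simp add: m_ac)
    also have "\<dots> = n \<otimes> (p \<otimes> s)" using c e(1) by (simp add: m_assoc)
    also have "\<dots> = q \<otimes> (n \<otimes> r)" using c e(2) by (simp add: m_lcomm)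
    finally have "m \<otimes> s = n \<otimes> r" using c l_cancel by simp
    then show "((m, n), (r, s)) \<in> frac_rel G" using c by (simp add: frac_rel_def)
  qed
qed

lemma frac_eq_iff:
  assumes "m \<in> carrier G" "n \<in> carrier G" "p \<in> carrier G" "q \<in> carrier G"
  shows "frac G m n = frac G p q \<longleftrightarrow> m \<otimes> q = n \<otimes> p"
  using eq_equiv_class_iff[OF equiv_frac_rel, of "(m, n)" "(p, q)"] assms
  by (auto simp: frac_def frac_rel_def)

lemma Groth_carrierE:
  assumes "x \<in> carrier (Groth G)"
  obtains m n where "m \<in> carrier G" "n \<in> carrier G" "x = frac G m n"
  using assms by (auto simp: Groth_def frac_def elim!: quotientE)

lemma frac_closed:
  "\<lbrakk>m \<in> carrier G; n \<in> carrier G\<rbrakk> \<Longrightarrow> frac G m n \<in> carrier (Groth G)"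
  by (auto simp: Groth_def frac_def intro!: quotientI)

lemma Groth_mult_frac:
  assumes c: "m \<in> carrier G" "n \<in> carrier G" "p \<in> carrier G" "q \<in> carrier G"
  shows "frac G m n \<otimes>\<^bsub>Groth G\<^esub> frac G p q = frac G (m \<otimes> p) (n \<otimes> q)"
proof -
  have eq: "frac G (m' \<otimes> p') (n' \<otimes> q') = frac G (m \<otimes> p) (n \<otimes> q)"
    if "(m', n') \<in> frac G m n" "(p', q') \<in> frac G p q" for m' n' p' q'
  proof -
    have c': "m' \<in> carrier G" "n' \<in> carrier G" "p' \<in> carrier G" "q' \<in> carrier G"
      and e: "m \<otimes> n' = n \<otimes> m'" "p \<otimes> q' = q \<otimes> p'"
      using that by (auto simp: frac_def frac_rel_def)
    have "(m' \<otimes> p') \<otimes> (n \<otimes> q) = (n \<otimes> m') \<otimes> (q \<otimes> p')" using c c' by (simp add: m_ac)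
    also have "\<dots> = (m \<otimes> n') \<otimes> (p \<otimes> q')" using e by simp
    also have "\<dots> = (n' \<otimes> q') \<otimes> (m \<otimes> p)" using c c' by (simp add: m_ac)
    finally show ?thesis using c c' by (simp add: frac_eq_iff)
  qed
  have "(m, n) \<in> frac G m n" "(p, q) \<in> frac G p q"
    using c by (auto simp: frac_def frac_rel_def m_comm)
  then have "(\<Union>(m', n') \<in> frac G m n. \<Union>(p', q') \<in> frac G p q. frac G (m' \<otimes> p') (n' \<otimes> q'))
      = frac G (m \<otimes> p) (n \<otimes> q)" (is "?U = ?F")
  proof (intro equalityI subsetI)
    fix z assume "z \<in> ?U"
    then obtain m' n' p' q' where "(m', n') \<in> frac G m n" "(p', q') \<in> frac G p q"
        "z \<in> frac G (m' \<otimes> p') (n' \<otimes> q')"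
      by blast
    then show "z \<in> ?F" using eq by simp
  qed blast
  then show ?thesis
    by (simp add: Groth_def)
qed

lemma Groth_comm_group: "comm_group (Groth G)"
proof (rule comm_groupI)
  show "\<one>\<^bsub>Groth G\<^esub> \<in> carrier (Groth G)"
    using frac_closed[of \<one> \<one>] by (simp add: Groth_def)
next
  fix x assume "x \<in> carrier (Groth G)"
  then obtain m n where x: "m \<in> carrier G" "n \<in> carrier G" "x = frac G m n"
    by (rule Groth_carrierE)
  have one: "\<one>\<^bsub>Groth G\<^esub> = frac G \<one> \<one>" by (simp add: Groth_def)
  show "\<one>\<^bsub>Groth G\<^esub> \<otimes>\<^bsub>Groth G\<^esub> x = x"
    using x by (simp add: one Groth_mult_frac)
  have "frac G n m \<otimes>\<^bsub>Groth G\<^esub> x = \<one>\<^bsub>Groth G\<^esub>"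
    using x by (simp add: one Groth_mult_frac frac_eq_iff m_comm)
  then show "\<exists>y\<in>carrier (Groth G). y \<otimes>\<^bsub>Groth G\<^esub> x = \<one>\<^bsub>Groth G\<^esub>"
    using x frac_closed by blast
next
  fix x y assume "x \<in> carrier (Groth G)" "y \<in> carrier (Groth G)"
  then obtain m n p q where xy: "m \<in> carrier G" "n \<in> carrier G" "x = frac G m n"
      "p \<in> carrier G" "q \<in> carrier G" "y = frac G p q"
    by (metis Groth_carrierE)
  show "x \<otimes>\<^bsub>Groth G\<^esub> y \<in> carrier (Groth G)"
    using xy by (simp add: Groth_mult_frac frac_closed)
  show "x \<otimes>\<^bsub>Groth G\<^esub> y = y \<otimes>\<^bsub>Groth G\<^esub> x"
    using xy by (simp add: Groth_mult_frac m_comm)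
  fix z assume "z \<in> carrier (Groth G)"
  then obtain r s where z: "r \<in> carrier G" "s \<in> carrier G" "z = frac G r s"
    by (rule Groth_carrierE)
  show "x \<otimes>\<^bsub>Groth G\<^esub> y \<otimes>\<^bsub>Groth G\<^esub> z = x \<otimes>\<^bsub>Groth G\<^esub> (y \<otimes>\<^bsub>Groth G\<^esub> z)"
    using xy z by (simp add: Groth_mult_frac m_assoc)
qed

lemma Groth_incl_hom: "Groth_incl G \<in> hom G (Groth G)"
  by (auto simp: hom_def Groth_incl_def Groth_mult_frac frac_closed)

lemma inj_on_Groth_incl: "inj_on (Groth_incl G) (carrier G)"
  by (auto simp: inj_on_def Groth_incl_def frac_eq_iff)

end


section \<open>The function algebras\<close>

text \<open>Functions on a carrier are represented as extensional functions, so that equality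
  of functions is equality on the carrier.\<close>

definition fun_alg ::
    "('g, 'm) monoid_scheme \<Rightarrow> ('r, 's) ring_scheme \<Rightarrow> ('r, 'g \<Rightarrow> 'r) module" where
  "fun_alg \<Gamma> R =
     \<lparr> carrier = carrier \<Gamma> \<rightarrow>\<^sub>E carrier R,
       monoid.mult = (\<lambda>\<alpha> \<beta>. \<lambda>n \<in> carrier \<Gamma>.
         finsum R (\<lambda>(a, b). \<alpha> a \<otimes>\<^bsub>R\<^esub> \<beta> b)
           {(a, b). a \<in> carrier \<Gamma> \<and> b \<in> carrier \<Gamma> \<and> a \<otimes>\<^bsub>\<Gamma>\<^esub> b = n}),
       one = (\<lambda>n \<in> carrier \<Gamma>. if n = \<one>\<^bsub>\<Gamma>\<^esub> then \<one>\<^bsub>R\<^esub> else \<zero>\<^bsub>R\<^esub>),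
       ring.zero = (\<lambda>n \<in> carrier \<Gamma>. \<zero>\<^bsub>R\<^esub>),
       ring.add = (\<lambda>\<alpha> \<beta>. \<lambda>n \<in> carrier \<Gamma>. \<alpha> n \<oplus>\<^bsub>R\<^esub> \<beta> n),
       smult = (\<lambda>r \<alpha>. \<lambda>n \<in> carrier \<Gamma>. r \<otimes>\<^bsub>R\<^esub> \<alpha> n) \<rparr>"

text \<open>The indices of the nonzero terms of the sum defining the product at \<open>q\<close>.  The set of
  all pairs with product \<open>q\<close> may be infinite, and \<open>finsum\<close> over an infinite set is zero, so
  the product below has to be taken over the nonzero terms only.\<close>

definition conv_supp ::
    "('g, 'm) monoid_scheme \<Rightarrow> ('r, 's) ring_scheme \<Rightarrow> (('g \<times> 'g) set \<Rightarrow> 'r) \<Rightarrow>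
     (('g \<times> 'g) set \<Rightarrow> 'r) \<Rightarrow> ('g \<times> 'g) set \<Rightarrow> (('g \<times> 'g) set \<times> ('g \<times> 'g) set) set" where
  "conv_supp \<Gamma> R \<alpha> \<beta> q =
     {(q', q''). q' \<in> carrier (Groth \<Gamma>) \<and> q'' \<in> carrier (Groth \<Gamma>) \<and>
        q' \<otimes>\<^bsub>Groth \<Gamma>\<^esub> q'' = q \<and> \<alpha> q' \<otimes>\<^bsub>R\<^esub> \<beta> q'' \<noteq> \<zero>\<^bsub>R\<^esub>}"

definition frac_fun_alg ::
    "('g, 'm) monoid_scheme \<Rightarrow> ('r, 's) ring_scheme \<Rightarrow> ('r, ('g \<times> 'g) set \<Rightarrow> 'r) module" where
  "frac_fun_alg \<Gamma> R =
     \<lparr> carrier = {\<alpha> \<in> carrier (Groth \<Gamma>) \<rightarrow>\<^sub>E carrier R.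
         \<exists>d \<in> carrier \<Gamma>. \<forall>q \<in> carrier (Groth \<Gamma>).
           \<alpha> q \<noteq> \<zero>\<^bsub>R\<^esub> \<longrightarrow> Groth_incl \<Gamma> d \<otimes>\<^bsub>Groth \<Gamma>\<^esub> q \<in> Groth_image \<Gamma>},
       monoid.mult = (\<lambda>\<alpha> \<beta>. \<lambda>q \<in> carrier (Groth \<Gamma>).
         finsum R (\<lambda>(q', q''). \<alpha> q' \<otimes>\<^bsub>R\<^esub> \<beta> q'') (conv_supp \<Gamma> R \<alpha> \<beta> q)),
       one = (\<lambda>q \<in> carrier (Groth \<Gamma>). if q = \<one>\<^bsub>Groth \<Gamma>\<^esub> then \<one>\<^bsub>R\<^esub> else \<zero>\<^bsub>R\<^esub>),
       ring.zero = (\<lambda>q \<in> carrier (Groth \<Gamma>). \<zero>\<^bsub>R\<^esub>),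
       ring.add = (\<lambda>\<alpha> \<beta>. \<lambda>q \<in> carrier (Groth \<Gamma>). \<alpha> q \<oplus>\<^bsub>R\<^esub> \<beta> q),
       smult = (\<lambda>r \<alpha>. \<lambda>q \<in> carrier (Groth \<Gamma>). r \<otimes>\<^bsub>R\<^esub> \<alpha> q) \<rparr>"

definition ext_zero ::
    "('g, 'm) monoid_scheme \<Rightarrow> ('r, 's) ring_scheme \<Rightarrow> ('g \<Rightarrow> 'r) \<Rightarrow> ('g \<times> 'g) set \<Rightarrow> 'r" where
  "ext_zero \<Gamma> R \<alpha> = (\<lambda>q \<in> carrier (Groth \<Gamma>).
     if q \<in> Groth_image \<Gamma> then \<alpha> (inv_into (carrier \<Gamma>) (Groth_incl \<Gamma>) q) else \<zero>\<^bsub>R\<^esub>)"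

definition algebra_hom ::
    "('r, 's) ring_scheme \<Rightarrow> ('r, 'a, 't) module_scheme \<Rightarrow> ('r, 'b, 'u) module_scheme \<Rightarrow>
     ('a \<Rightarrow> 'b) set" where
  "algebra_hom R A B = {h \<in> ring_hom A B.
     \<forall>r \<in> carrier R. \<forall>x \<in> carrier A. h (r \<odot>\<^bsub>A\<^esub> x) = r \<odot>\<^bsub>B\<^esub> h x}"

end

theory Submission
  imports Defs
begin

text \<open>
  Write \<open>Q\<close> for the Grothendieck group and \<open>d\<^sup>-\<^sup>1\<Gamma>\<close> for the set of \<open>q \<in> Q\<close> with \<open>dq \<in> \<Gamma>\<close>. An element of the
  function algebra on \<open>Q\<close> is a function supported in some \<open>d\<^sup>-\<^sup>1\<Gamma>\<close>. If \<open>x \<in> d\<^sup>-\<^sup>1\<Gamma>\<close>, \<open>y \<in> e\<^sup>-\<^sup>1\<Gamma>\<close> and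
  \<open>xy = q\<close>, then \<open>(dx)(ey) = deq\<close> is a factorization within \<open>\<Gamma>\<close> that determines \<open>(x, y)\<close>. So, by the
  finite type condition, there are finitely many such pairs (\<open>finite_factor_pairs\<close>), the product is
  a finite sum, and it is supported in \<open>(de)\<^sup>-\<^sup>1\<Gamma>\<close> (\<open>F_over_mult\<close>).

  The product can therefore be computed over the fixed finite index set of all factorizations in
  \<open>d\<^sup>-\<^sup>1\<Gamma> \<times> e\<^sup>-\<^sup>1\<Gamma>\<close> instead of over the nonzero terms (\<open>F_mult_over\<close>), and the algebra laws become
  manipulations of finite sums; associativity (\<open>F_mult_assoc\<close>) compares two double sums over
  factorizations of \<open>q\<close> into three factors.

  Extension by zero is injective and respects the operations, because a nonzero term in the product
  of two extensions comes from a factorization within \<open>\<Gamma>\<close> (\<open>conv_supp_ext_zero\<close>). The algebra laws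
  for functions on \<open>\<Gamma>\<close> then follow from those on \<open>Q\<close> by pulling them back along this injection
  (\<open>algebra_inj_transfer\<close>).
\<close>


section \<open>Preliminaries on finite sums and algebras\<close>

lemma (in abelian_monoid) finsum_Sigma:
  assumes "finite A" "\<And>x. x \<in> A \<Longrightarrow> finite (B x)"
    and "\<And>x y. x \<in> A \<Longrightarrow> y \<in> B x \<Longrightarrow> f x y \<in> carrier G"
  shows "(\<Oplus>p\<in>Sigma A B. f (fst p) (snd p)) = (\<Oplus>x\<in>A. \<Oplus>y\<in>B x. f x y)"
proof -
  have "Sigma A B = (\<Union>x\<in>A. Pair x ` B x)" by auto
  then have "(\<Oplus>p\<in>Sigma A B. f (fst p) (snd p))
      = (\<Oplus>x\<in>A. \<Oplus>p\<in>Pair x ` B x. f (fst p) (snd p))"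
    using assms
    by (auto intro!: add.finprod_UN_disjoint simp: pairwise_def disjnt_def)
  also have "\<dots> = (\<Oplus>x\<in>A. \<Oplus>y\<in>B x. f x y)"
  proof (rule finsum_cong')
    fix x assume x: "x \<in> A"
    have "(\<Oplus>p\<in>Pair x ` B x. f (fst p) (snd p)) = (\<Oplus>y\<in>B x. f (fst (x, y)) (snd (x, y)))"
      using assms(3)[OF x] by (intro finsum_reindex) (auto simp: inj_on_def)
    then show "(\<Oplus>p\<in>Pair x ` B x. f (fst p) (snd p)) = (\<Oplus>y\<in>B x. f x y)" by simp
  qed (use assms in \<open>auto intro!: finsum_closed\<close>)
  finally show ?thesis .
qed

text \<open>A structure that is closed under the algebra operations and admits an injective homomorphism
  into an algebra is itself an algebra.\<close>

lemma algebra_inj_transfer: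
  fixes R (structure) and A (structure) and B (structure)
  assumes B: "algebra R B"
    and hom: "h \<in> algebra_hom R A B" and inj: "inj_on h (carrier A)"
    and zero: "\<zero>\<^bsub>A\<^esub> \<in> carrier A" "h \<zero>\<^bsub>A\<^esub> = \<zero>\<^bsub>B\<^esub>"
    and one: "\<one>\<^bsub>A\<^esub> \<in> carrier A"
    and add: "\<And>x y. x \<in> carrier A \<Longrightarrow> y \<in> carrier A \<Longrightarrow> x \<oplus>\<^bsub>A\<^esub> y \<in> carrier A"
    and mult: "\<And>x y. x \<in> carrier A \<Longrightarrow> y \<in> carrier A \<Longrightarrow> x \<otimes>\<^bsub>A\<^esub> y \<in> carrier A"
    and smult: "\<And>r x. r \<in> carrier R \<Longrightarrow> x \<in> carrier A \<Longrightarrow> r \<odot>\<^bsub>A\<^esub> x \<in> carrier A"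
  shows "algebra R A"
proof -
  interpret B: algebra R B by (rule B)
  have h: "x \<in> carrier A \<Longrightarrow> h x \<in> carrier B"
    "\<lbrakk>x \<in> carrier A; y \<in> carrier A\<rbrakk> \<Longrightarrow> h (x \<otimes>\<^bsub>A\<^esub> y) = h x \<otimes>\<^bsub>B\<^esub> h y"
    "\<lbrakk>x \<in> carrier A; y \<in> carrier A\<rbrakk> \<Longrightarrow> h (x \<oplus>\<^bsub>A\<^esub> y) = h x \<oplus>\<^bsub>B\<^esub> h y"
    "h \<one>\<^bsub>A\<^esub> = \<one>\<^bsub>B\<^esub>"
    "\<lbrakk>r \<in> carrier R; x \<in> carrier A\<rbrakk> \<Longrightarrow> h (r \<odot>\<^bsub>A\<^esub> x) = r \<odot>\<^bsub>B\<^esub> h x" for x y r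
    using hom by (auto simp: algebra_hom_def ring_hom_def)
  note closed = zero(1) one add mult smult
  have eqI: "x = y" if "h x = h y" "x \<in> carrier A" "y \<in> carrier A" for x y
    using inj that by (auto simp: inj_on_def)
  have neg: "\<exists>y\<in>carrier A. y \<oplus>\<^bsub>A\<^esub> x = \<zero>\<^bsub>A\<^esub>" if x: "x \<in> carrier A" for x
  proof (rule bexI)
    \<comment> \<open>Additive inverses come from the scalar \<open>-1\<close>.\<close>
    show y: "(\<ominus> \<one>) \<odot>\<^bsub>A\<^esub> x \<in> carrier A" using x by (simp add: closed)
    show "(\<ominus> \<one>) \<odot>\<^bsub>A\<^esub> x \<oplus>\<^bsub>A\<^esub> x = \<zero>\<^bsub>A\<^esub>"
      using x y
      by (intro eqI) (simp_all add: h closed zero B.smult_l_minus B.M.l_neg)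
  qed
  show ?thesis
  proof (rule algebraI)
    show "cring A"
    proof (rule cringI)
      show "abelian_group A"
        by (rule abelian_groupI)
          (use neg in \<open>auto intro!: eqI simp: h closed zero B.M.a_ac\<close>)
      show "comm_monoid A"
        by (rule comm_monoidI)
          (auto intro!: eqI simp: h closed B.m_ac)
    qed (auto intro!: eqI simp: h closed B.l_distr)
  qed (auto intro!: eqI simp: h closed B.smult_l_distr B.smult_r_distr B.smult_assoc1
      B.smult_assoc2 B.R.cring_axioms intro: B.R.cring_axioms)
qed

section \<open>The Grothendieck group of a cancellative monoid of finite type\<close>

text \<open>The commutative monoid \<open>\<Gamma>\<close>, its Grothendieck group \<open>Q\<close> with multiplication \<open>\<bullet>\<close>, the inclusion \<open>\<iota>\<close>, and the
  algebra \<open>F\<close> of functions on \<open>Q\<close> with bounded denominators and values in \<open>R\<close>.\<close>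

locale frac_functions = R?: cring R + \<Gamma>?: comm_monoid_cancel \<Gamma>
  for R :: "('r, 's) ring_scheme" (structure) and \<Gamma> :: "('g, 'm) monoid_scheme" +
  assumes finite_type: "finite_type \<Gamma>"
begin

sublocale Q: comm_group "Groth \<Gamma>"
  by (rule Groth_comm_group)

abbreviation Q_mult (infixl "\<bullet>" 70) where "x \<bullet> y \<equiv> x \<otimes>\<^bsub>Groth \<Gamma>\<^esub> y"

abbreviation \<iota> where "\<iota> \<equiv> Groth_incl \<Gamma>"

abbreviation Q where "Q \<equiv> carrier (Groth \<Gamma>)"

abbreviation F where "F \<equiv> frac_fun_alg \<Gamma> R"

lemma incl_closed [simp]: "n \<in> carrier \<Gamma> \<Longrightarrow> \<iota> n \<in> Q"
  using Groth_incl_hom by (auto simp: hom_def)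

lemma incl_mult: "m \<in> carrier \<Gamma> \<Longrightarrow> n \<in> carrier \<Gamma> \<Longrightarrow> \<iota> (m \<otimes>\<^bsub>\<Gamma>\<^esub> n) = \<iota> m \<bullet> \<iota> n"
  using Groth_incl_hom by (auto simp: hom_def)

lemma incl_one: "\<iota> \<one>\<^bsub>\<Gamma>\<^esub> = \<one>\<^bsub>Groth \<Gamma>\<^esub>"
  by (simp add: Groth_incl_def Groth_def)

lemma incl_eq_iff: "m \<in> carrier \<Gamma> \<Longrightarrow> n \<in> carrier \<Gamma> \<Longrightarrow> \<iota> m = \<iota> n \<longleftrightarrow> m = n"
  using inj_on_Groth_incl by (auto simp: inj_on_def)


section \<open>Fractions over a common denominator\<close>

text \<open>The set \<open>d\<^sup>-\<^sup>1\<Gamma>\<close> of the fractions that have \<open>d\<close> as a denominator.\<close>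

definition fracs_over :: "'g \<Rightarrow> ('g \<times> 'g) set set" where
  "fracs_over d = {q \<in> Q. \<iota> d \<bullet> q \<in> Groth_image \<Gamma>}"

lemma fracs_over_carrier: "q \<in> fracs_over d \<Longrightarrow> q \<in> Q"
  by (simp add: fracs_over_def)

lemma fracs_over_mult:
  assumes "d \<in> carrier \<Gamma>" "e \<in> carrier \<Gamma>" "x \<in> fracs_over d" "y \<in> fracs_over e"
  shows "x \<bullet> y \<in> fracs_over (d \<otimes>\<^bsub>\<Gamma>\<^esub> e)"
proof -
  from assms obtain m n where mn: "m \<in> carrier \<Gamma>" "n \<in> carrier \<Gamma>" "\<iota> d \<bullet> x = \<iota> m" "\<iota> e \<bullet> y = \<iota> n"
    and xy: "x \<in> Q" "y \<in> Q"
    by (auto simp: fracs_over_def)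
  have "\<iota> (d \<otimes>\<^bsub>\<Gamma>\<^esub> e) \<bullet> (x \<bullet> y) = (\<iota> d \<bullet> x) \<bullet> (\<iota> e \<bullet> y)"
    using assms xy by (simp add: incl_mult Q.m_ac)
  also have "\<dots> = \<iota> (m \<otimes>\<^bsub>\<Gamma>\<^esub> n)"
    using mn by (simp add: incl_mult)
  finally show ?thesis
    using mn xy by (simp add: fracs_over_def)
qed

lemma incl_in_fracs_over_one: "n \<in> carrier \<Gamma> \<Longrightarrow> \<iota> n \<in> fracs_over \<one>\<^bsub>\<Gamma>\<^esub>"
  by (simp add: fracs_over_def incl_one)

lemma fracs_over_subset:
  assumes "d \<in> carrier \<Gamma>" "e \<in> carrier \<Gamma>"
  shows "fracs_over d \<subseteq> fracs_over (d \<otimes>\<^bsub>\<Gamma>\<^esub> e)"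
proof
  fix x assume x: "x \<in> fracs_over d"
  have "\<one>\<^bsub>Groth \<Gamma>\<^esub> \<in> fracs_over e"
    using assms by (simp add: fracs_over_def)
  from fracs_over_mult[OF assms x this] show "x \<in> fracs_over (d \<otimes>\<^bsub>\<Gamma>\<^esub> e)"
    using x by (simp add: fracs_over_carrier)
qed

text \<open>The factorizations of \<open>q\<close> with first factor in \<open>A\<close> and second factor in \<open>B\<close>.\<close>

definition factor_pairs where
  "factor_pairs A B q = {(a, b). a \<in> A \<and> b \<in> B \<and> a \<bullet> b = q}"

text \<open>The map \<open>(x, y) \<mapsto> (dx, ey)\<close> is injective and sends these factorizations of \<open>q\<close> to factorizations
  of \<open>deq\<close> in \<open>\<Gamma>\<close>, of which there are finitely many since \<open>\<Gamma>\<close> is of finite type.\<close>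

lemma finite_factor_pairs:
  assumes d: "d \<in> carrier \<Gamma>" and e: "e \<in> carrier \<Gamma>"
  shows "finite (factor_pairs (fracs_over d) (fracs_over e) q)"
proof (cases "factor_pairs (fracs_over d) (fracs_over e) q = {}")
  case False
  then obtain a b where ab: "a \<in> fracs_over d" "b \<in> fracs_over e" "a \<bullet> b = q"
    by (auto simp: factor_pairs_def)
  from fracs_over_mult[OF d e ab(1,2)] obtain n
    where n: "n \<in> carrier \<Gamma>" "\<iota> (d \<otimes>\<^bsub>\<Gamma>\<^esub> e) \<bullet> q = \<iota> n"
    by (auto simp: fracs_over_def ab(3))
  let ?f = "\<lambda>(x, y). (\<iota> d \<bullet> x, \<iota> e \<bullet> y)"
  let ?S = "{(a, b). a \<in> carrier \<Gamma> \<and> b \<in> carrier \<Gamma> \<and> n = a \<otimes>\<^bsub>\<Gamma>\<^esub> b}"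
  have "?f ` factor_pairs (fracs_over d) (fracs_over e) q \<subseteq> (\<lambda>(a, b). (\<iota> a, \<iota> b)) ` ?S"
  proof clarify
    fix x y assume "(x, y) \<in> factor_pairs (fracs_over d) (fracs_over e) q"
    then obtain k l where kl: "k \<in> carrier \<Gamma>" "l \<in> carrier \<Gamma>" "\<iota> d \<bullet> x = \<iota> k" "\<iota> e \<bullet> y = \<iota> l"
      and xy: "x \<in> Q" "y \<in> Q" "x \<bullet> y = q"
      by (auto simp: factor_pairs_def fracs_over_def)
    have "\<iota> n = (\<iota> d \<bullet> x) \<bullet> (\<iota> e \<bullet> y)"
      using xy d e by (simp add: n(2)[symmetric] incl_mult xy(3)[symmetric] Q.m_ac)
    then have "n = k \<otimes>\<^bsub>\<Gamma>\<^esub> l"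
      using kl n by (simp flip: incl_mult add: incl_eq_iff)
    then show "(\<iota> d \<bullet> x, \<iota> e \<bullet> y) \<in> (\<lambda>(a, b). (\<iota> a, \<iota> b)) ` ?S"
      using kl by force
  qed
  moreover have "finite ?S"
    using finite_type n(1) by (simp add: finite_type_def)
  moreover have "inj_on ?f (factor_pairs (fracs_over d) (fracs_over e) q)"
    using d e by (auto simp: inj_on_def factor_pairs_def fracs_over_def)
  ultimately show ?thesis
    by (meson finite_imageI finite_imageD finite_subset)
qed simp


section \<open>The algebra of functions with bounded denominators\<close>

lemma F_simps:
  "\<one>\<^bsub>F\<^esub> = (\<lambda>q \<in> Q. if q = \<one>\<^bsub>Groth \<Gamma>\<^esub> then \<one> else \<zero>)"
  "\<zero>\<^bsub>F\<^esub> = (\<lambda>q \<in> Q. \<zero>)"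
  "\<alpha> \<oplus>\<^bsub>F\<^esub> \<beta> = (\<lambda>q \<in> Q. \<alpha> q \<oplus> \<beta> q)"
  "r \<odot>\<^bsub>F\<^esub> \<alpha> = (\<lambda>q \<in> Q. r \<otimes> \<alpha> q)"
  by (simp_all add: frac_fun_alg_def)

lemma F_apply:
  assumes "q \<in> Q"
  shows "\<zero>\<^bsub>F\<^esub> q = \<zero>" "(\<alpha> \<oplus>\<^bsub>F\<^esub> \<beta>) q = \<alpha> q \<oplus> \<beta> q" "(r \<odot>\<^bsub>F\<^esub> \<alpha>) q = r \<otimes> \<alpha> q"
  using assms by (simp_all add: F_simps)

text \<open>The functions with support in \<open>d\<^sup>-\<^sup>1\<Gamma>\<close>. The carrier of \<open>F\<close> is the union of these sets over all
  \<open>d\<close> in \<open>\<Gamma>\<close>, and the product of the sets for \<open>d\<close> and \<open>e\<close> lies in the set for \<open>de\<close>.\<close>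

definition F_over :: "'g \<Rightarrow> (('g \<times> 'g) set \<Rightarrow> 'r) set" where
  "F_over d = {\<alpha> \<in> Q \<rightarrow>\<^sub>E carrier R. \<forall>q\<in>Q. \<alpha> q \<noteq> \<zero> \<longrightarrow> q \<in> fracs_over d}"

lemma F_over_memI:
  assumes "\<alpha> \<in> extensional Q" "\<And>q. q \<in> Q \<Longrightarrow> \<alpha> q \<in> carrier R"
    and "\<And>q. q \<in> Q \<Longrightarrow> \<alpha> q \<noteq> \<zero> \<Longrightarrow> q \<in> fracs_over d"
  shows "\<alpha> \<in> F_over d"
  using assms by (auto simp: F_over_def PiE_def)

lemma F_over_supp: "\<alpha> \<in> F_over d \<Longrightarrow> q \<in> Q \<Longrightarrow> q \<notin> fracs_over d \<Longrightarrow> \<alpha> q = \<zero>"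
  by (auto simp: F_over_def)

lemma F_carrier: "\<alpha> \<in> carrier F \<longleftrightarrow> (\<exists>d\<in>carrier \<Gamma>. \<alpha> \<in> F_over d)"
  by (auto simp: frac_fun_alg_def F_over_def fracs_over_def)

lemma F_overI: "d \<in> carrier \<Gamma> \<Longrightarrow> \<alpha> \<in> F_over d \<Longrightarrow> \<alpha> \<in> carrier F"
  by (auto simp: F_carrier)

lemma F_carrierE:
  assumes "\<alpha> \<in> carrier F"
  obtains d where "d \<in> carrier \<Gamma>" "\<alpha> \<in> F_over d"
  using assms by (auto simp: F_carrier)

lemma F_over_closed [simp]: "\<alpha> \<in> F_over d \<Longrightarrow> q \<in> Q \<Longrightarrow> \<alpha> q \<in> carrier R"
  by (auto simp: F_over_def)

lemma F_closed [simp]: "\<alpha> \<in> carrier F \<Longrightarrow> q \<in> Q \<Longrightarrow> \<alpha> q \<in> carrier R"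
  by (auto simp: F_carrier)

lemma F_extensional: "\<alpha> \<in> carrier F \<Longrightarrow> \<alpha> \<in> extensional Q"
  by (elim F_carrierE) (simp only: F_over_def mem_Collect_eq PiE_iff)

lemma F_eqI:
  assumes "\<alpha> \<in> carrier F" "\<beta> \<in> carrier F" "\<And>q. q \<in> Q \<Longrightarrow> \<alpha> q = \<beta> q"
  shows "\<alpha> = \<beta>"
  using assms by (intro extensionalityI[of _ Q]) (auto simp: F_extensional)

text \<open>Two functions with denominators \<open>d\<close> and \<open>e\<close> both have the denominator \<open>de\<close>.\<close>

lemma F_over_common:
  assumes "\<alpha> \<in> carrier F" "\<beta> \<in> carrier F"
  obtains d where "d \<in> carrier \<Gamma>" "\<alpha> \<in> F_over d" "\<beta> \<in> F_over d"
proof -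
  obtain d e where de: "d \<in> carrier \<Gamma>" "e \<in> carrier \<Gamma>" "\<alpha> \<in> F_over d" "\<beta> \<in> F_over e"
    using assms by (auto simp: F_carrier)
  have "\<alpha> \<in> F_over (d \<otimes>\<^bsub>\<Gamma>\<^esub> e)"
    using fracs_over_subset[of d e] de by (auto simp: F_over_def)
  moreover have "\<beta> \<in> F_over (d \<otimes>\<^bsub>\<Gamma>\<^esub> e)"
    using fracs_over_subset[of e d] de by (auto simp: F_over_def \<Gamma>.m_comm[of d e])
  ultimately show thesis
    using that[of "d \<otimes>\<^bsub>\<Gamma>\<^esub> e"] de by simp
qed

lemma conv_supp_subset:
  assumes "\<alpha> \<in> F_over d" "\<beta> \<in> F_over e"
  shows "conv_supp \<Gamma> R \<alpha> \<beta> q \<subseteq> factor_pairs (fracs_over d) (fracs_over e) q"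
proof clarify
  fix x y assume "(x, y) \<in> conv_supp \<Gamma> R \<alpha> \<beta> q"
  then have xy: "x \<in> Q" "y \<in> Q" "x \<bullet> y = q" "\<alpha> x \<otimes> \<beta> y \<noteq> \<zero>"
    by (auto simp: conv_supp_def)
  then have "\<alpha> x \<noteq> \<zero>" "\<beta> y \<noteq> \<zero>"
    using assms by auto
  then show "(x, y) \<in> factor_pairs (fracs_over d) (fracs_over e) q"
    using xy assms by (auto simp: F_over_def factor_pairs_def)
qed

lemma finite_conv_supp:
  assumes "\<alpha> \<in> carrier F" "\<beta> \<in> carrier F"
  shows "finite (conv_supp \<Gamma> R \<alpha> \<beta> q)"
proof -
  obtain d e where "d \<in> carrier \<Gamma>" "e \<in> carrier \<Gamma>" "\<alpha> \<in> F_over d" "\<beta> \<in> F_over e"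
    using assms by (auto simp: F_carrier)
  then show ?thesis
    using conv_supp_subset finite_factor_pairs finite_subset by metis
qed

text \<open>The product may be computed over any finite set of factorizations that contains all nonzero
  terms; this frees the index set from its dependence on the factors.\<close>

lemma F_mult_superset:
  assumes "\<alpha> \<in> carrier F" "\<beta> \<in> carrier F" "q \<in> Q" and S: "finite S"
    "conv_supp \<Gamma> R \<alpha> \<beta> q \<subseteq> S" "S \<subseteq> factor_pairs Q Q q"
  shows "(\<alpha> \<otimes>\<^bsub>F\<^esub> \<beta>) q = (\<Oplus>p\<in>S. \<alpha> (fst p) \<otimes> \<beta> (snd p))"
proof -
  have "(\<Oplus>p\<in>conv_supp \<Gamma> R \<alpha> \<beta> q. \<alpha> (fst p) \<otimes> \<beta> (snd p)) = (\<Oplus>p\<in>S. \<alpha> (fst p) \<otimes> \<beta> (snd p))"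
    using S assms(1-3)
    by (intro R.add.finprod_mono_neutral_cong_left) (auto simp: conv_supp_def factor_pairs_def)
  then show ?thesis
    using assms(3) by (simp add: frac_fun_alg_def case_prod_unfold)
qed

lemma F_mult_over:
  assumes "d \<in> carrier \<Gamma>" "e \<in> carrier \<Gamma>" "\<alpha> \<in> F_over d" "\<beta> \<in> F_over e" "q \<in> Q"
  shows "(\<alpha> \<otimes>\<^bsub>F\<^esub> \<beta>) q
    = (\<Oplus>p\<in>factor_pairs (fracs_over d) (fracs_over e) q. \<alpha> (fst p) \<otimes> \<beta> (snd p))"
  using assms
  by (intro F_mult_superset finite_factor_pairs conv_supp_subset)
    (auto simp: F_carrier factor_pairs_def fracs_over_carrier)

lemma F_over_mult:
  assumes "d \<in> carrier \<Gamma>" "e \<in> carrier \<Gamma>" "\<alpha> \<in> F_over d" "\<beta> \<in> F_over e"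
  shows "\<alpha> \<otimes>\<^bsub>F\<^esub> \<beta> \<in> F_over (d \<otimes>\<^bsub>\<Gamma>\<^esub> e)"
proof -
  have "\<alpha> \<otimes>\<^bsub>F\<^esub> \<beta> \<in> extensional Q"
    by (simp add: frac_fun_alg_def)
  moreover have "(\<alpha> \<otimes>\<^bsub>F\<^esub> \<beta>) q \<in> carrier R" if "q \<in> Q" for q
    using assms that
    by (auto simp: F_mult_over factor_pairs_def fracs_over_carrier intro!: finsum_closed)
  moreover have "q \<in> fracs_over (d \<otimes>\<^bsub>\<Gamma>\<^esub> e)" if "q \<in> Q" "(\<alpha> \<otimes>\<^bsub>F\<^esub> \<beta>) q \<noteq> \<zero>" for q
  proof -
    have "factor_pairs (fracs_over d) (fracs_over e) q \<noteq> {}"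
    proof
      assume "factor_pairs (fracs_over d) (fracs_over e) q = {}"
      with F_mult_over[OF assms that(1)] that(2) show False by simp
    qed
    then show ?thesis
      using fracs_over_mult[OF assms(1,2)] by (auto simp: factor_pairs_def)
  qed
  ultimately show ?thesis
    by (rule F_over_memI)
qed

lemma F_mult_closed: "\<alpha> \<in> carrier F \<Longrightarrow> \<beta> \<in> carrier F \<Longrightarrow> \<alpha> \<otimes>\<^bsub>F\<^esub> \<beta> \<in> carrier F"
  by (elim F_carrierE, rule F_overI, rule \<Gamma>.m_closed, assumption+, rule F_over_mult)

lemma F_over_add: "\<alpha> \<in> F_over d \<Longrightarrow> \<beta> \<in> F_over d \<Longrightarrow> \<alpha> \<oplus>\<^bsub>F\<^esub> \<beta> \<in> F_over d"
  by (rule F_over_memI) (auto simp: F_simps F_over_supp intro: ccontr)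

lemma F_over_smult: "r \<in> carrier R \<Longrightarrow> \<alpha> \<in> F_over d \<Longrightarrow> r \<odot>\<^bsub>F\<^esub> \<alpha> \<in> F_over d"
  by (rule F_over_memI) (auto simp: F_simps F_over_supp intro: ccontr)

lemma F_add_closed: "\<alpha> \<in> carrier F \<Longrightarrow> \<beta> \<in> carrier F \<Longrightarrow> \<alpha> \<oplus>\<^bsub>F\<^esub> \<beta> \<in> carrier F"
  by (rule F_over_common[of \<alpha> \<beta>], assumption+) (rule F_overI, assumption, rule F_over_add)

lemma F_smult_closed: "r \<in> carrier R \<Longrightarrow> \<alpha> \<in> carrier F \<Longrightarrow> r \<odot>\<^bsub>F\<^esub> \<alpha> \<in> carrier F"
  by (erule F_carrierE) (rule F_overI, assumption, rule F_over_smult)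

lemma F_zero_closed: "\<zero>\<^bsub>F\<^esub> \<in> carrier F"
  by (rule F_overI[of "\<one>\<^bsub>\<Gamma>\<^esub>"]) (auto intro!: F_over_memI simp: F_simps)

lemma F_one_closed: "\<one>\<^bsub>F\<^esub> \<in> carrier F"
  by (rule F_overI[of "\<one>\<^bsub>\<Gamma>\<^esub>"])
    (auto intro!: F_over_memI simp: F_simps incl_in_fracs_over_one
      simp flip: incl_one split: if_splits)

lemmas F_ops_closed = F_mult_closed F_add_closed F_smult_closed F_zero_closed F_one_closed

text \<open>With a common denominator for both factors, the index set of the product is invariant under
  exchanging the components of its pairs.\<close>

lemma F_mult_comm:
  assumes "\<alpha> \<in> carrier F" "\<beta> \<in> carrier F"
  shows "\<alpha> \<otimes>\<^bsub>F\<^esub> \<beta> = \<beta> \<otimes>\<^bsub>F\<^esub> \<alpha>"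
proof (rule F_eqI)
  fix q assume q: "q \<in> Q"
  obtain d where d: "d \<in> carrier \<Gamma>" "\<alpha> \<in> F_over d" "\<beta> \<in> F_over d"
    using assms by (rule F_over_common)
  let ?S = "factor_pairs (fracs_over d) (fracs_over d) q"
  have swap: "?S = prod.swap ` ?S"
    by (force simp: factor_pairs_def fracs_over_carrier Q.m_comm)
  have "(\<alpha> \<otimes>\<^bsub>F\<^esub> \<beta>) q = (\<Oplus>p\<in>prod.swap ` ?S. \<alpha> (fst p) \<otimes> \<beta> (snd p))"
    using d q by (simp add: F_mult_over flip: swap)
  also have "\<dots> = (\<Oplus>p\<in>?S. \<alpha> (fst (prod.swap p)) \<otimes> \<beta> (snd (prod.swap p)))"
    using assms
    by (intro R.finsum_reindex) (auto simp: factor_pairs_def fracs_over_carrier inj_on_def)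
  also have "\<dots> = (\<Oplus>p\<in>?S. \<beta> (fst p) \<otimes> \<alpha> (snd p))"
    using assms
    by (intro R.finsum_cong') (auto simp: factor_pairs_def fracs_over_carrier R.m_comm)
  also have "\<dots> = (\<beta> \<otimes>\<^bsub>F\<^esub> \<alpha>) q"
    using d q by (simp add: F_mult_over)
  finally show "(\<alpha> \<otimes>\<^bsub>F\<^esub> \<beta>) q = (\<beta> \<otimes>\<^bsub>F\<^esub> \<alpha>) q" .
qed (use assms in \<open>auto intro: F_mult_closed\<close>)

text \<open>Both bracketings are rewritten as a sum over triples, indexed by nested pairs; the two index
  sets correspond under \<open>((ab, c), (a, b)) \<mapsto> ((a, bc), (b, c))\<close>.\<close>

lemma F_mult_assoc:
  assumes "\<alpha> \<in> carrier F" "\<beta> \<in> carrier F" "\<gamma> \<in> carrier F"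
  shows "(\<alpha> \<otimes>\<^bsub>F\<^esub> \<beta>) \<otimes>\<^bsub>F\<^esub> \<gamma> = \<alpha> \<otimes>\<^bsub>F\<^esub> (\<beta> \<otimes>\<^bsub>F\<^esub> \<gamma>)"
proof (rule F_eqI)
  fix q assume q: "q \<in> Q"
  from assms obtain d e f where den: "d \<in> carrier \<Gamma>" "e \<in> carrier \<Gamma>" "f \<in> carrier \<Gamma>"
    and supp: "\<alpha> \<in> F_over d" "\<beta> \<in> F_over e" "\<gamma> \<in> F_over f"
    by (auto simp: F_carrier)
  define D where "D = fracs_over d"
  define E where "E = fracs_over e"
  define F' where "F' = fracs_over f"
  define DE where "DE = fracs_over (d \<otimes>\<^bsub>\<Gamma>\<^esub> e)"
  define EF where "EF = fracs_over (e \<otimes>\<^bsub>\<Gamma>\<^esub> f)"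
  note defs = D_def E_def F'_def DE_def EF_def
  define S where "S = Sigma (factor_pairs DE F' q) (\<lambda>p. factor_pairs D E (fst p))"
  define T where "T = Sigma (factor_pairs D EF q) (\<lambda>p. factor_pairs E F' (snd p))"
  have sub: "D \<subseteq> Q" "E \<subseteq> Q" "F' \<subseteq> Q" "DE \<subseteq> Q" "EF \<subseteq> Q"
    by (auto simp: defs fracs_over_carrier)
  have prod: "x \<in> D \<Longrightarrow> y \<in> E \<Longrightarrow> x \<bullet> y \<in> DE" "y \<in> E \<Longrightarrow> z \<in> F' \<Longrightarrow> y \<bullet> z \<in> EF" for x y z
    using den by (auto simp: defs fracs_over_mult)
  have fin: "finite (factor_pairs D E x)" "finite (factor_pairs E F' x)"
    "finite (factor_pairs DE F' x)" "finite (factor_pairs D EF x)" for x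
    using den by (auto simp: defs finite_factor_pairs)
  have clo: "\<alpha> x \<in> carrier R" "\<beta> x \<in> carrier R" "\<gamma> x \<in> carrier R" if "x \<in> Q" for x
    using that assms by auto
  note pairs = factor_pairs_def sub[THEN subsetD] clo
  have "((\<alpha> \<otimes>\<^bsub>F\<^esub> \<beta>) \<otimes>\<^bsub>F\<^esub> \<gamma>) q
      = (\<Oplus>p\<in>factor_pairs DE F' q. (\<alpha> \<otimes>\<^bsub>F\<^esub> \<beta>) (fst p) \<otimes> \<gamma> (snd p))"
    using den supp q unfolding defs by (intro F_mult_over F_over_mult) auto
  also have "\<dots> = (\<Oplus>p\<in>factor_pairs DE F' q. \<Oplus>r\<in>factor_pairs D E (fst p).
      \<alpha> (fst r) \<otimes> \<beta> (snd r) \<otimes> \<gamma> (snd p))"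
  proof (rule R.finsum_cong')
    fix p assume p: "p \<in> factor_pairs DE F' q"
    then have pQ: "fst p \<in> Q" "snd p \<in> Q"
      by (auto simp: pairs)
    have "(\<alpha> \<otimes>\<^bsub>F\<^esub> \<beta>) (fst p) = (\<Oplus>r\<in>factor_pairs D E (fst p). \<alpha> (fst r) \<otimes> \<beta> (snd r))"
      using den supp pQ unfolding defs by (intro F_mult_over) auto
    then show "(\<alpha> \<otimes>\<^bsub>F\<^esub> \<beta>) (fst p) \<otimes> \<gamma> (snd p)
        = (\<Oplus>r\<in>factor_pairs D E (fst p). \<alpha> (fst r) \<otimes> \<beta> (snd r) \<otimes> \<gamma> (snd p))"
      using pQ by (simp, intro R.finsum_ldistr fin) (auto simp: pairs)
  next
    show "(\<lambda>p. \<Oplus>r\<in>factor_pairs D E (fst p). \<alpha> (fst r) \<otimes> \<beta> (snd r) \<otimes> \<gamma> (snd p))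
        \<in> factor_pairs DE F' q \<rightarrow> carrier R"
      by (intro Pi_I R.finsum_closed) (auto simp: pairs)
  qed simp
  also have "\<dots> = (\<Oplus>s\<in>S. \<alpha> (fst (snd s)) \<otimes> \<beta> (snd (snd s)) \<otimes> \<gamma> (snd (fst s)))"
    unfolding S_def
    by (intro R.finsum_Sigma[symmetric] fin) (auto simp: pairs)
  also have "\<dots> = (\<Oplus>s\<in>S. \<alpha> (fst (snd s)) \<otimes> (\<beta> (snd (snd s)) \<otimes> \<gamma> (snd (fst s))))"
    unfolding S_def
    by (intro R.finsum_cong') (auto simp: pairs R.m_assoc)
  also have "\<dots> = (\<Oplus>t\<in>T. \<alpha> (fst (fst t)) \<otimes> (\<beta> (fst (snd t)) \<otimes> \<gamma> (snd (snd t))))"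
  proof -
    let ?h = "\<lambda>((x, c), (a, b)). ((a, b \<bullet> c), (b, c))"
    have "inj_on ?h S"
      by (auto simp: inj_on_def S_def factor_pairs_def)
    moreover have "?h ` S = T"
    proof
      show "?h ` S \<subseteq> T"
        using prod sub
        by (auto simp: S_def T_def factor_pairs_def Q.m_assoc subset_iff)
      show "T \<subseteq> ?h ` S"
      proof
        fix t assume "t \<in> T"
        then obtain a b c where abc: "t = ((a, b \<bullet> c), (b, c))" "a \<in> D" "b \<in> E" "c \<in> F'"
          "a \<bullet> (b \<bullet> c) = q"
          by (auto simp: T_def factor_pairs_def)
        then have "((a \<bullet> b, c), (a, b)) \<in> S"
          using prod sub by (auto simp: S_def factor_pairs_def Q.m_assoc subset_iff)
        then show "t \<in> ?h ` S"
          using abc(1) by force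
      qed
    qed
    moreover have "(\<Oplus>t\<in>?h ` S. \<alpha> (fst (fst t)) \<otimes> (\<beta> (fst (snd t)) \<otimes> \<gamma> (snd (snd t))))
        = (\<Oplus>s\<in>S. \<alpha> (fst (fst (?h s))) \<otimes> (\<beta> (fst (snd (?h s))) \<otimes> \<gamma> (snd (snd (?h s)))))"
      using \<open>inj_on ?h S\<close>
      by (intro R.finsum_reindex) (auto simp: S_def pairs)
    ultimately show ?thesis
      by (simp add: case_prod_unfold)
  qed
  also have "\<dots> = (\<Oplus>p\<in>factor_pairs D EF q. \<Oplus>r\<in>factor_pairs E F' (snd p).
      \<alpha> (fst p) \<otimes> (\<beta> (fst r) \<otimes> \<gamma> (snd r)))"
    unfolding T_def
    by (intro R.finsum_Sigma fin) (auto simp: pairs)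
  also have "\<dots> = (\<Oplus>p\<in>factor_pairs D EF q. \<alpha> (fst p) \<otimes> (\<beta> \<otimes>\<^bsub>F\<^esub> \<gamma>) (snd p))"
  proof (rule R.finsum_cong')
    fix p assume p: "p \<in> factor_pairs D EF q"
    then have pQ: "fst p \<in> Q" "snd p \<in> Q"
      by (auto simp: pairs)
    have "(\<beta> \<otimes>\<^bsub>F\<^esub> \<gamma>) (snd p) = (\<Oplus>r\<in>factor_pairs E F' (snd p). \<beta> (fst r) \<otimes> \<gamma> (snd r))"
      using den supp pQ unfolding defs by (intro F_mult_over) auto
    then show "(\<Oplus>r\<in>factor_pairs E F' (snd p). \<alpha> (fst p) \<otimes> (\<beta> (fst r) \<otimes> \<gamma> (snd r)))
        = \<alpha> (fst p) \<otimes> (\<beta> \<otimes>\<^bsub>F\<^esub> \<gamma>) (snd p)"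
      using pQ by (simp, intro R.finsum_rdistr[symmetric] fin) (auto simp: pairs)
  next
    show "(\<lambda>p. \<alpha> (fst p) \<otimes> (\<beta> \<otimes>\<^bsub>F\<^esub> \<gamma>) (snd p)) \<in> factor_pairs D EF q \<rightarrow> carrier R"
      using assms by (auto simp: pairs F_mult_closed)
  qed simp
  also have "\<dots> = (\<alpha> \<otimes>\<^bsub>F\<^esub> (\<beta> \<otimes>\<^bsub>F\<^esub> \<gamma>)) q"
    using den supp q unfolding defs by (intro F_mult_over[symmetric] F_over_mult) auto
  finally show "((\<alpha> \<otimes>\<^bsub>F\<^esub> \<beta>) \<otimes>\<^bsub>F\<^esub> \<gamma>) q = (\<alpha> \<otimes>\<^bsub>F\<^esub> (\<beta> \<otimes>\<^bsub>F\<^esub> \<gamma>)) q" .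
qed (use assms in \<open>auto intro: F_mult_closed\<close>)

lemma F_mult_one:
  assumes "\<alpha> \<in> carrier F"
  shows "\<one>\<^bsub>F\<^esub> \<otimes>\<^bsub>F\<^esub> \<alpha> = \<alpha>"
proof (rule F_eqI)
  fix q assume q: "q \<in> Q"
  have "(\<one>\<^bsub>F\<^esub> \<otimes>\<^bsub>F\<^esub> \<alpha>) q = (\<Oplus>p\<in>{(\<one>\<^bsub>Groth \<Gamma>\<^esub>, q)}. \<one>\<^bsub>F\<^esub> (fst p) \<otimes> \<alpha> (snd p))"
    using assms q
    by (intro F_mult_superset)
      (auto simp: conv_supp_def factor_pairs_def F_one_closed[unfolded F_simps] F_simps
        split: if_splits)
  then show "(\<one>\<^bsub>F\<^esub> \<otimes>\<^bsub>F\<^esub> \<alpha>) q = \<alpha> q"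
    using assms q by (simp add: F_simps)
qed (simp_all add: assms F_ops_closed)

lemma F_mult_add_distr:
  assumes "\<alpha> \<in> carrier F" "\<beta> \<in> carrier F" "\<gamma> \<in> carrier F"
  shows "(\<alpha> \<oplus>\<^bsub>F\<^esub> \<beta>) \<otimes>\<^bsub>F\<^esub> \<gamma> = \<alpha> \<otimes>\<^bsub>F\<^esub> \<gamma> \<oplus>\<^bsub>F\<^esub> \<beta> \<otimes>\<^bsub>F\<^esub> \<gamma>"
proof (rule F_eqI)
  fix q assume q: "q \<in> Q"
  obtain d where d: "d \<in> carrier \<Gamma>" "\<alpha> \<in> F_over d" "\<beta> \<in> F_over d"
    using assms(1,2) by (rule F_over_common)
  obtain e where e: "e \<in> carrier \<Gamma>" "\<gamma> \<in> F_over e"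
    using assms(3) by (rule F_carrierE)
  let ?S = "factor_pairs (fracs_over d) (fracs_over e) q"
  note pairs = factor_pairs_def fracs_over_carrier
  have "((\<alpha> \<oplus>\<^bsub>F\<^esub> \<beta>) \<otimes>\<^bsub>F\<^esub> \<gamma>) q = (\<Oplus>p\<in>?S. (\<alpha> \<oplus>\<^bsub>F\<^esub> \<beta>) (fst p) \<otimes> \<gamma> (snd p))"
    using d e q by (intro F_mult_over F_over_add)
  also have "\<dots> = (\<Oplus>p\<in>?S. \<alpha> (fst p) \<otimes> \<gamma> (snd p) \<oplus> \<beta> (fst p) \<otimes> \<gamma> (snd p))"
    using assms by (intro R.finsum_cong') (auto simp: pairs F_simps R.l_distr)
  also have "\<dots> = (\<Oplus>p\<in>?S. \<alpha> (fst p) \<otimes> \<gamma> (snd p)) \<oplus> (\<Oplus>p\<in>?S. \<beta> (fst p) \<otimes> \<gamma> (snd p))"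
    using assms by (intro R.finsum_addf) (auto simp: pairs)
  also have "\<dots> = (\<alpha> \<otimes>\<^bsub>F\<^esub> \<gamma> \<oplus>\<^bsub>F\<^esub> \<beta> \<otimes>\<^bsub>F\<^esub> \<gamma>) q"
    using q
    by (simp add: F_simps(3) F_mult_over[OF d(1) e(1) d(2) e(2)]
        F_mult_over[OF d(1) e(1) d(3) e(2)])
  finally show "((\<alpha> \<oplus>\<^bsub>F\<^esub> \<beta>) \<otimes>\<^bsub>F\<^esub> \<gamma>) q = (\<alpha> \<otimes>\<^bsub>F\<^esub> \<gamma> \<oplus>\<^bsub>F\<^esub> \<beta> \<otimes>\<^bsub>F\<^esub> \<gamma>) q" .
qed (simp_all add: assms F_ops_closed)

lemma F_smult_mult:
  assumes "r \<in> carrier R" "\<alpha> \<in> carrier F" "\<beta> \<in> carrier F"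
  shows "(r \<odot>\<^bsub>F\<^esub> \<alpha>) \<otimes>\<^bsub>F\<^esub> \<beta> = r \<odot>\<^bsub>F\<^esub> (\<alpha> \<otimes>\<^bsub>F\<^esub> \<beta>)"
proof (rule F_eqI)
  fix q assume q: "q \<in> Q"
  obtain d where d: "d \<in> carrier \<Gamma>" "\<alpha> \<in> F_over d" "\<beta> \<in> F_over d"
    using assms(2,3) by (rule F_over_common)
  let ?S = "factor_pairs (fracs_over d) (fracs_over d) q"
  note pairs = factor_pairs_def fracs_over_carrier
  have "((r \<odot>\<^bsub>F\<^esub> \<alpha>) \<otimes>\<^bsub>F\<^esub> \<beta>) q = (\<Oplus>p\<in>?S. (r \<odot>\<^bsub>F\<^esub> \<alpha>) (fst p) \<otimes> \<beta> (snd p))"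
    using d q assms(1) by (intro F_mult_over F_over_smult)
  also have "\<dots> = (\<Oplus>p\<in>?S. r \<otimes> (\<alpha> (fst p) \<otimes> \<beta> (snd p)))"
    using assms by (intro R.finsum_cong') (auto simp: pairs F_simps R.m_assoc)
  also have "\<dots> = r \<otimes> (\<Oplus>p\<in>?S. \<alpha> (fst p) \<otimes> \<beta> (snd p))"
    using assms d
    by (intro R.finsum_rdistr[symmetric] finite_factor_pairs) (auto simp: pairs)
  also have "\<dots> = (r \<odot>\<^bsub>F\<^esub> (\<alpha> \<otimes>\<^bsub>F\<^esub> \<beta>)) q"
    using q by (simp add: F_simps(4) F_mult_over[OF d(1) d(1) d(2) d(3)])
  finally show "((r \<odot>\<^bsub>F\<^esub> \<alpha>) \<otimes>\<^bsub>F\<^esub> \<beta>) q = (r \<odot>\<^bsub>F\<^esub> (\<alpha> \<otimes>\<^bsub>F\<^esub> \<beta>)) q" .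
qed (simp_all add: assms F_ops_closed)

lemma F_algebra: "algebra R F"
proof (rule algebraI)
  show "cring F"
  proof (rule cringI)
    show "abelian_group F"
    proof (rule abelian_groupI)
      fix \<alpha> assume \<alpha>: "\<alpha> \<in> carrier F"
      show "\<exists>\<beta>\<in>carrier F. \<beta> \<oplus>\<^bsub>F\<^esub> \<alpha> = \<zero>\<^bsub>F\<^esub>"
      \<comment> \<open>The additive inverse is the scalar multiple by \<open>-1\<close>, so no separate support estimate is needed.\<close>
      proof (rule bexI)
        show c: "(\<ominus> \<one>) \<odot>\<^bsub>F\<^esub> \<alpha> \<in> carrier F"
          using \<alpha> by (simp add: F_smult_closed)
        show "(\<ominus> \<one>) \<odot>\<^bsub>F\<^esub> \<alpha> \<oplus>\<^bsub>F\<^esub> \<alpha> = \<zero>\<^bsub>F\<^esub>"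
          using \<alpha> c by (intro F_eqI) (simp_all add: F_ops_closed F_apply R.l_minus R.l_neg)
      qed
    qed (auto intro!: F_eqI simp: F_ops_closed F_apply R.a_ac)
    show "comm_monoid F"
      by (rule comm_monoidI)
        (rule F_ops_closed F_mult_assoc F_mult_one F_mult_comm; assumption)+
  qed (rule F_mult_add_distr)
qed (auto intro!: F_eqI intro: R.cring_axioms
    simp: F_ops_closed F_apply R.l_distr R.r_distr R.m_assoc F_smult_mult)


section \<open>Extension by zero\<close>

abbreviation A where "A \<equiv> fun_alg \<Gamma> R"

lemma A_carrier: "carrier A = carrier \<Gamma> \<rightarrow>\<^sub>E carrier R"
  by (simp add: fun_alg_def)

lemma A_closed [simp]: "\<alpha> \<in> carrier A \<Longrightarrow> n \<in> carrier \<Gamma> \<Longrightarrow> \<alpha> n \<in> carrier R"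
  by (auto simp: A_carrier)

lemma A_simps:
  "\<one>\<^bsub>A\<^esub> = (\<lambda>n \<in> carrier \<Gamma>. if n = \<one>\<^bsub>\<Gamma>\<^esub> then \<one> else \<zero>)"
  "\<zero>\<^bsub>A\<^esub> = (\<lambda>n \<in> carrier \<Gamma>. \<zero>)"
  "\<alpha> \<oplus>\<^bsub>A\<^esub> \<beta> = (\<lambda>n \<in> carrier \<Gamma>. \<alpha> n \<oplus> \<beta> n)"
  "r \<odot>\<^bsub>A\<^esub> \<alpha> = (\<lambda>n \<in> carrier \<Gamma>. r \<otimes> \<alpha> n)"
  by (simp_all add: fun_alg_def)

lemma A_mult:
  "n \<in> carrier \<Gamma> \<Longrightarrow> (\<alpha> \<otimes>\<^bsub>A\<^esub> \<beta>) n =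
    (\<Oplus>p\<in>{(a, b). a \<in> carrier \<Gamma> \<and> b \<in> carrier \<Gamma> \<and> a \<otimes>\<^bsub>\<Gamma>\<^esub> b = n}. \<alpha> (fst p) \<otimes> \<beta> (snd p))"
  by (simp add: fun_alg_def case_prod_unfold)

lemma A_mult_closed: "\<alpha> \<in> carrier A \<Longrightarrow> \<beta> \<in> carrier A \<Longrightarrow> \<alpha> \<otimes>\<^bsub>A\<^esub> \<beta> \<in> carrier A"
proof -
  assume ab: "\<alpha> \<in> carrier A" "\<beta> \<in> carrier A"
  have "\<alpha> \<otimes>\<^bsub>A\<^esub> \<beta> \<in> extensional (carrier \<Gamma>)"
    by (simp add: fun_alg_def)
  moreover have "(\<alpha> \<otimes>\<^bsub>A\<^esub> \<beta>) n \<in> carrier R" if "n \<in> carrier \<Gamma>" for n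
    unfolding A_mult[OF that] using ab by (intro R.finsum_closed) auto
  ultimately show ?thesis
    by (simp only: A_carrier PiE_iff) blast
qed

lemma ext_zero_incl [simp]: "n \<in> carrier \<Gamma> \<Longrightarrow> ext_zero \<Gamma> R \<alpha> (\<iota> n) = \<alpha> n"
  by (simp add: ext_zero_def inv_into_f_f[OF inj_on_Groth_incl])

lemma ext_zero_outside [simp]: "q \<in> Q \<Longrightarrow> q \<notin> Groth_image \<Gamma> \<Longrightarrow> ext_zero \<Gamma> R \<alpha> q = \<zero>"
  by (simp add: ext_zero_def)

lemma ext_zero_closed: "\<alpha> \<in> carrier A \<Longrightarrow> ext_zero \<Gamma> R \<alpha> \<in> carrier F"
proof (rule F_overI[of "\<one>\<^bsub>\<Gamma>\<^esub>"])
  assume \<alpha>: "\<alpha> \<in> carrier A"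
  have "ext_zero \<Gamma> R \<alpha> q \<in> carrier R" if "q \<in> Q" for q
    using that \<alpha> by (cases "q \<in> Groth_image \<Gamma>") auto
  moreover have "q \<in> fracs_over \<one>\<^bsub>\<Gamma>\<^esub>" if "q \<in> Q" "ext_zero \<Gamma> R \<alpha> q \<noteq> \<zero>" for q
    using that by (cases "q \<in> Groth_image \<Gamma>") (auto simp: incl_in_fracs_over_one)
  moreover have "ext_zero \<Gamma> R \<alpha> \<in> extensional Q"
    by (simp add: ext_zero_def)
  ultimately show "ext_zero \<Gamma> R \<alpha> \<in> F_over \<one>\<^bsub>\<Gamma>\<^esub>"
    by (intro F_over_memI)
qed simp

text \<open>An element of \<open>F\<close> that vanishes outside \<open>\<Gamma>\<close> is the extension of its restriction to \<open>\<Gamma>\<close>.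
  Every compatibility of the extension with the algebra operations is an instance.\<close>

lemma ext_zero_eqI:
  assumes "\<beta> \<in> carrier F"
    and "\<And>n. n \<in> carrier \<Gamma> \<Longrightarrow> \<alpha> n = \<beta> (\<iota> n)"
    and "\<And>q. q \<in> Q \<Longrightarrow> q \<notin> Groth_image \<Gamma> \<Longrightarrow> \<beta> q = \<zero>"
  shows "ext_zero \<Gamma> R \<alpha> = \<beta>"
proof (rule extensionalityI[of _ Q])
  fix q assume "q \<in> Q"
  then show "ext_zero \<Gamma> R \<alpha> q = \<beta> q"
    using assms by (cases "q \<in> Groth_image \<Gamma>") auto
qed (use assms(1) in \<open>auto simp: ext_zero_def F_extensional\<close>)

text \<open>In a product of two extensions, only factorizations within \<open>\<Gamma>\<close> contribute. Hence the product at
  \<open>\<iota> n\<close> is the finite convolution in \<open>\<Gamma>\<close>, and it vanishes outside \<open>\<Gamma>\<close>.\<close>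

lemma conv_supp_ext_zero:
  assumes "\<alpha> \<in> carrier A" "\<beta> \<in> carrier A"
  shows "conv_supp \<Gamma> R (ext_zero \<Gamma> R \<alpha>) (ext_zero \<Gamma> R \<beta>) q
    \<subseteq> {(\<iota> a, \<iota> b) |a b. a \<in> carrier \<Gamma> \<and> b \<in> carrier \<Gamma> \<and> \<iota> (a \<otimes>\<^bsub>\<Gamma>\<^esub> b) = q}"
proof clarify
  fix x y assume "(x, y) \<in> conv_supp \<Gamma> R (ext_zero \<Gamma> R \<alpha>) (ext_zero \<Gamma> R \<beta>) q"
  then have xy: "x \<in> Q" "y \<in> Q" "x \<bullet> y = q" "ext_zero \<Gamma> R \<alpha> x \<otimes> ext_zero \<Gamma> R \<beta> y \<noteq> \<zero>"
    by (auto simp: conv_supp_def)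
  have "x \<in> Groth_image \<Gamma>"
    using xy ext_zero_closed[OF assms(2)] by (metis F_closed R.l_null ext_zero_outside)
  moreover have "y \<in> Groth_image \<Gamma>"
    using xy ext_zero_closed[OF assms(1)] by (metis F_closed R.r_null ext_zero_outside)
  ultimately obtain a b where "a \<in> carrier \<Gamma>" "b \<in> carrier \<Gamma>" "x = \<iota> a" "y = \<iota> b"
    by blast
  then show "\<exists>a b. (x, y) = (\<iota> a, \<iota> b) \<and> a \<in> carrier \<Gamma> \<and> b \<in> carrier \<Gamma> \<and> \<iota> (a \<otimes>\<^bsub>\<Gamma>\<^esub> b) = q"
    using xy(3) incl_mult by blast
qed

lemma ext_zero_mult:
  assumes "\<alpha> \<in> carrier A" "\<beta> \<in> carrier A"
  shows "ext_zero \<Gamma> R (\<alpha> \<otimes>\<^bsub>A\<^esub> \<beta>) = ext_zero \<Gamma> R \<alpha> \<otimes>\<^bsub>F\<^esub> ext_zero \<Gamma> R \<beta>"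
proof (rule ext_zero_eqI)
  fix n assume n: "n \<in> carrier \<Gamma>"
  let ?S = "{(a, b). a \<in> carrier \<Gamma> \<and> b \<in> carrier \<Gamma> \<and> a \<otimes>\<^bsub>\<Gamma>\<^esub> b = n}"
  let ?i = "\<lambda>(a, b). (\<iota> a, \<iota> b)"
  have "?S = {(a, b). a \<in> carrier \<Gamma> \<and> b \<in> carrier \<Gamma> \<and> n = a \<otimes>\<^bsub>\<Gamma>\<^esub> b}"
    by auto
  then have fin: "finite ?S"
    using finite_type n by (simp add: finite_type_def)
  have sub: "conv_supp \<Gamma> R (ext_zero \<Gamma> R \<alpha>) (ext_zero \<Gamma> R \<beta>) (\<iota> n) \<subseteq> ?i ` ?S"
    by (rule order_trans[OF conv_supp_ext_zero[OF assms]]) (use n in \<open>force simp: incl_eq_iff\<close>)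
  have "(ext_zero \<Gamma> R \<alpha> \<otimes>\<^bsub>F\<^esub> ext_zero \<Gamma> R \<beta>) (\<iota> n)
      = (\<Oplus>p\<in>?i ` ?S. ext_zero \<Gamma> R \<alpha> (fst p) \<otimes> ext_zero \<Gamma> R \<beta> (snd p))"
    using assms n sub fin
    by (intro F_mult_superset) (auto simp: ext_zero_closed factor_pairs_def incl_mult)
  also have "\<dots> = (\<Oplus>p\<in>?S. ext_zero \<Gamma> R \<alpha> (fst (?i p)) \<otimes> ext_zero \<Gamma> R \<beta> (snd (?i p)))"
    using assms
    by (intro R.finsum_reindex) (auto simp: inj_on_def incl_eq_iff)
  also have "\<dots> = (\<Oplus>p\<in>?S. \<alpha> (fst p) \<otimes> \<beta> (snd p))"
    using assms by (intro R.finsum_cong') auto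
  finally show "(\<alpha> \<otimes>\<^bsub>A\<^esub> \<beta>) n = (ext_zero \<Gamma> R \<alpha> \<otimes>\<^bsub>F\<^esub> ext_zero \<Gamma> R \<beta>) (\<iota> n)"
    using n by (simp add: A_mult)
next
  fix q assume q: "q \<in> Q" "q \<notin> Groth_image \<Gamma>"
  have "conv_supp \<Gamma> R (ext_zero \<Gamma> R \<alpha>) (ext_zero \<Gamma> R \<beta>) q \<subseteq> {}"
    by (rule order_trans[OF conv_supp_ext_zero[OF assms]]) (use q in auto)
  then show "(ext_zero \<Gamma> R \<alpha> \<otimes>\<^bsub>F\<^esub> ext_zero \<Gamma> R \<beta>) q = \<zero>"
    using q(1) by (simp add: frac_fun_alg_def)
qed (use assms in \<open>simp add: F_mult_closed ext_zero_closed\<close>)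

lemma ext_zero_hom: "ext_zero \<Gamma> R \<in> algebra_hom R A F"
proof -
  have "ext_zero \<Gamma> R (\<alpha> \<oplus>\<^bsub>A\<^esub> \<beta>) = ext_zero \<Gamma> R \<alpha> \<oplus>\<^bsub>F\<^esub> ext_zero \<Gamma> R \<beta>"
    if "\<alpha> \<in> carrier A" "\<beta> \<in> carrier A" for \<alpha> \<beta>
    using that
    by (intro ext_zero_eqI F_add_closed ext_zero_closed) (auto simp: A_simps F_simps)
  moreover have "ext_zero \<Gamma> R \<one>\<^bsub>A\<^esub> = \<one>\<^bsub>F\<^esub>"
    by (intro ext_zero_eqI F_one_closed)
      (auto simp: A_simps F_simps incl_eq_iff simp flip: incl_one)
  moreover have "ext_zero \<Gamma> R (r \<odot>\<^bsub>A\<^esub> \<alpha>) = r \<odot>\<^bsub>F\<^esub> ext_zero \<Gamma> R \<alpha>"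
    if "r \<in> carrier R" "\<alpha> \<in> carrier A" for r \<alpha>
    using that
    by (intro ext_zero_eqI F_smult_closed ext_zero_closed) (auto simp: A_simps F_simps)
  ultimately show ?thesis
    by (auto simp: algebra_hom_def intro!: ring_hom_memI ext_zero_closed ext_zero_mult)
qed

lemma ext_zero_inj: "inj_on (ext_zero \<Gamma> R) (carrier A)"
proof (rule inj_onI)
  fix \<alpha> \<beta> assume ab: "\<alpha> \<in> carrier A" "\<beta> \<in> carrier A" "ext_zero \<Gamma> R \<alpha> = ext_zero \<Gamma> R \<beta>"
  have "\<alpha> n = \<beta> n" if "n \<in> carrier \<Gamma>" for n
    using ext_zero_incl[OF that, of \<alpha>] ext_zero_incl[OF that, of \<beta>] ab(3) by simp
  with ab show "\<alpha> = \<beta>"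
    unfolding A_carrier by (intro PiE_ext) auto
qed

text \<open>The algebra laws for functions on \<open>\<Gamma>\<close> are inherited from \<open>F\<close> through the injection.\<close>

lemma A_algebra: "algebra R A"
proof (rule algebra_inj_transfer[OF F_algebra ext_zero_hom ext_zero_inj])
  show "ext_zero \<Gamma> R \<zero>\<^bsub>A\<^esub> = \<zero>\<^bsub>F\<^esub>"
    by (intro ext_zero_eqI F_zero_closed) (auto simp: A_simps F_simps)
qed (auto simp: A_mult_closed[unfolded A_carrier] A_simps A_carrier)

end


section \<open>The extension of algebras\<close>

theorem proposition3p2:
  fixes R :: "('r, 's) ring_scheme" and \<Gamma> :: "('g, 'm) monoid_scheme"
  assumes "cring R"
    and "comm_monoid_cancel \<Gamma>"
    and "finite_type \<Gamma>"
  shows "(\<forall>\<alpha> \<in> carrier (frac_fun_alg \<Gamma> R). \<forall>\<beta> \<in> carrier (frac_fun_alg \<Gamma> R).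
           \<forall>q \<in> carrier (Groth \<Gamma>). finite (conv_supp \<Gamma> R \<alpha> \<beta> q)) \<and>
         algebra R (frac_fun_alg \<Gamma> R) \<and>
         algebra R (fun_alg \<Gamma> R) \<and>
         ext_zero \<Gamma> R \<in> algebra_hom R (fun_alg \<Gamma> R) (frac_fun_alg \<Gamma> R) \<and>
         inj_on (ext_zero \<Gamma> R) (carrier (fun_alg \<Gamma> R)) \<and>
         subcring (ext_zero \<Gamma> R ` carrier (fun_alg \<Gamma> R)) (frac_fun_alg \<Gamma> R) \<and>
         ext_zero \<Gamma> R \<in> ring_iso (fun_alg \<Gamma> R)
           (frac_fun_alg \<Gamma> R \<lparr> carrier := ext_zero \<Gamma> R ` carrier (fun_alg \<Gamma> R) \<rparr>)"
proof -
  interpret frac_functions R \<Gamma>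
    using assms by (simp add: frac_functions_def frac_functions_axioms_def)
  interpret A: cring A by (rule algebra.axioms(2)[OF A_algebra])
  interpret F: cring F by (rule algebra.axioms(2)[OF F_algebra])
  have hom: "ext_zero \<Gamma> R \<in> ring_hom A F"
    using ext_zero_hom by (simp add: algebra_hom_def)
  then interpret h: ring_hom_ring A F "ext_zero \<Gamma> R"
    by (intro ring_hom_ringI2 A.ring_axioms F.ring_axioms)
  have "subcring (ext_zero \<Gamma> R ` carrier A) F"
    by (intro F.subcringI' h.img_is_subring A.carrier_is_subring)
  moreover have "ext_zero \<Gamma> R \<in> ring_iso A (F \<lparr> carrier := ext_zero \<Gamma> R ` carrier A \<rparr>)"
    using hom ext_zero_inj by (auto simp: ring_iso_def ring_hom_def bij_betw_def)
  ultimately show ?thesis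
    using finite_conv_supp F_algebra A_algebra ext_zero_hom ext_zero_inj by blast
qed

end
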